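(* Let $\mu\geq 3$ be an integer. Every $\mu$-way $(v,3,2)$ trade of minimum volume (i.e., whose volume equals the minimum volume of all $\mu$-way $(v',3,2)$ trades) is a Steiner trade.
   Context: A $(v,k,t)$ trade is a triple $(X;T_1,T_2)$ where $X$ is a $v$-set and $T_1,T_2$ are disjoint nonempty collections of $k$-subsets (blocks) of $X$ such that every $t$-subset of $X$ is contained in the same number of blocks of $T_1$ as of $T_2$. A $\mu$-way $(v,k,t)$ trade is a pair $T=(X,\{T_1,\dots,T_\mu\})$ such that for every $i\neq j$, $(X;T_i,T_j)$ is a $(v,k,t)$ trade. The volume of $T$ is the common number of blocks of the $T_i$. A $\mu$-way $(v,k,t)$ trade is a Steiner trade if every $t$-subset of $X$ is contained in at most one block of each $T_i$. *)

theory Defs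
  imports Main
begin

definition is_trade ::
  "nat \<Rightarrow> nat \<Rightarrow> nat \<Rightarrow> 'a set \<Rightarrow> 'a set set \<Rightarrow> 'a set set \<Rightarrow> bool" where
  "is_trade v k t X T1 T2 \<longleftrightarrow>
     finite X \<and> card X = v \<and>
     T1 \<noteq> {} \<and> T2 \<noteq> {} \<and> T1 \<inter> T2 = {} \<and>
     (\<forall>B \<in> T1 \<union> T2. B \<subseteq> X \<and> card B = k) \<and>
     (\<forall>S. S \<subseteq> X \<and> card S = t \<longrightarrow> card {B \<in> T1. S \<subseteq> B} = card {B \<in> T2. S \<subseteq> B})"

text \<open>The collections of a \<open>\<mu>\<close>-way trade form a family indexed by \<open>{1..\<mu>}\<close>; values of
  the family outside this range are irrelevant.\<close>

definition is_mu_way_trade ::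
  "nat \<Rightarrow> nat \<Rightarrow> nat \<Rightarrow> nat \<Rightarrow> 'a set \<Rightarrow> (nat \<Rightarrow> 'a set set) \<Rightarrow> bool" where
  "is_mu_way_trade \<mu> v k t X T \<longleftrightarrow>
     (\<forall>i \<in> {1..\<mu>}. \<forall>j \<in> {1..\<mu>}. i \<noteq> j \<longrightarrow> is_trade v k t X (T i) (T j))"

definition has_volume :: "nat \<Rightarrow> (nat \<Rightarrow> 'a set set) \<Rightarrow> nat \<Rightarrow> bool" where
  "has_volume \<mu> T m \<longleftrightarrow> (\<forall>i \<in> {1..\<mu>}. card (T i) = m)"

definition is_steiner :: "nat \<Rightarrow> nat \<Rightarrow> 'a set \<Rightarrow> (nat \<Rightarrow> 'a set set) \<Rightarrow> bool" where
  "is_steiner \<mu> t X T \<longleftrightarrow>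
     (\<forall>S. S \<subseteq> X \<and> card S = t \<longrightarrow> (\<forall>i \<in> {1..\<mu>}. card {B \<in> T i. S \<subseteq> B} \<le> 1))"

text \<open>The minimum ranges over all (finite) point sets. Since every finite set is in bijection
  with a set of natural numbers, it suffices to let the point set range over sets of naturals,
  which makes the minimum independent of the point type of any particular trade.\<close>

definition min_volume :: "nat \<Rightarrow> nat \<Rightarrow> nat \<Rightarrow> nat" where
  "min_volume \<mu> k t =
     (LEAST m. \<exists>v' (X' :: nat set) T'. is_mu_way_trade \<mu> v' k t X' T' \<and> has_volume \<mu> T' m)"

end

theory Submission
  imports Defs
begin

text \<open>
  If some pair \<open>xy\<close> lies in at least two blocks of each \<open>T\<^sub>i\<close>, then the third points of the blocks
  through \<open>xy\<close> are distinct over all \<open>i\<close>, which gives at least \<open>2\<mu>\<close> of them. The same count in the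
  neighbourhood of a single point shows that every point of the trade lies in at least
  \<open>(\<mu> + 1)/2\<close> blocks of \<open>T\<^sub>1\<close>, and that \<open>x\<close> and \<open>y\<close> lie in at least \<open>\<mu> + 1\<close>. Summing degrees, the
  volume of a trade that is not Steiner is at least about \<open>(\<mu> + 1)(\<mu> + 2)/3\<close>.

  This is twice the volume of a Steiner triple system on \<open>\<mu> + 2\<close> points, so it suffices to
  exhibit trades that are moderately efficient. For \<open>\<mu> \<ge> 23\<close> these are obtained from a large set of
  seven disjoint Steiner triple systems of order 9 by replacing each point by \<open>g\<close> copies and each
  block by the \<open>g\<close> Latin squares \<open>a + b + c \<equiv> j (mod g)\<close>, which yields \<open>7g\<close> ways of volume
  \<open>12g\<^sup>2\<close>. Smaller \<open>\<mu>\<close> are covered by a few explicit systems.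
\<close>

section \<open>Elementary facts on \<mu>-way trades\<close>

text \<open>With fewer than two indices the definition is vacuous; from \<mu> = 2 on, every index
  has a partner, so properties of a single \<open>T i\<close> can be read off from the pairwise
  condition.\<close>

lemma mu_way_trade_iff:
  assumes "\<mu> \<ge> 2"
  shows "is_mu_way_trade \<mu> v k t X T \<longleftrightarrow>
    finite X \<and> card X = v \<and>
    (\<forall>i\<in>{1..\<mu>}. T i \<noteq> {} \<and> (\<forall>B\<in>T i. B \<subseteq> X \<and> card B = k)) \<and>
    (\<forall>i\<in>{1..\<mu>}. \<forall>j\<in>{1..\<mu>}. i \<noteq> j \<longrightarrow> T i \<inter> T j = {}) \<and>
    (\<forall>i\<in>{1..\<mu>}. \<forall>j\<in>{1..\<mu>}. \<forall>S. S \<subseteq> X \<and> card S = t \<longrightarrow>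
       card {B \<in> T i. S \<subseteq> B} = card {B \<in> T j. S \<subseteq> B})" (is "?L \<longleftrightarrow> ?R")
proof
  assume L: ?L
  have tr: "is_trade v k t X (T i) (T j)" if "i \<in> {1..\<mu>}" "j \<in> {1..\<mu>}" "i \<noteq> j" for i j
    using L that by (auto simp: is_mu_way_trade_def)
  have "\<exists>j\<in>{1..\<mu>}. i \<noteq> j" for i
    using assms by (intro bexI[of _ "if i = 1 then 2 else 1"]) auto
  then have ex: "\<exists>j. is_trade v k t X (T i) (T j)" if "i \<in> {1..\<mu>}" for i
    using tr that by blast
  have "finite X \<and> card X = v"
    using ex[of 1] assms by (auto simp: is_trade_def)
  moreover have "\<forall>i\<in>{1..\<mu>}. T i \<noteq> {} \<and> (\<forall>B\<in>T i. B \<subseteq> X \<and> card B = k)"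
  proof
    fix i assume "i \<in> {1..\<mu>}"
    from ex[OF this] show "T i \<noteq> {} \<and> (\<forall>B\<in>T i. B \<subseteq> X \<and> card B = k)"
      unfolding is_trade_def by blast
  qed
  moreover have "\<forall>i\<in>{1..\<mu>}. \<forall>j\<in>{1..\<mu>}. i \<noteq> j \<longrightarrow> T i \<inter> T j = {}"
    using tr unfolding is_trade_def by blast
  moreover have "card {B \<in> T i. S \<subseteq> B} = card {B \<in> T j. S \<subseteq> B}"
    if "i \<in> {1..\<mu>}" "j \<in> {1..\<mu>}" "S \<subseteq> X \<and> card S = t" for i j S
    using tr[of i j] that by (cases "i = j") (auto simp: is_trade_def)
  ultimately show ?R by blast
next
  assume ?R
  then show ?L unfolding is_mu_way_trade_def is_trade_def by blast
qed

lemma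
  assumes "\<mu> \<ge> 2" and "is_mu_way_trade \<mu> v k t X T"
  shows mu_way_trade_finite_points: "finite X"
    and mu_way_trade_block: "\<And>B i. B \<in> T i \<Longrightarrow> i \<in> {1..\<mu>} \<Longrightarrow> B \<subseteq> X \<and> card B = k"
    and mu_way_trade_finite: "\<And>i. i \<in> {1..\<mu>} \<Longrightarrow> finite (T i)"
    and mu_way_trade_disjoint: "\<And>i j. i \<in> {1..\<mu>} \<Longrightarrow> j \<in> {1..\<mu>} \<Longrightarrow> i \<noteq> j \<Longrightarrow> T i \<inter> T j = {}"
    and mu_way_trade_balanced: "\<And>i j S. i \<in> {1..\<mu>} \<Longrightarrow> j \<in> {1..\<mu>} \<Longrightarrow> S \<subseteq> X \<Longrightarrow> card S = t \<Longrightarrow>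
      card {B \<in> T i. S \<subseteq> B} = card {B \<in> T j. S \<subseteq> B}"
proof -
  note T = assms(2)[unfolded mu_way_trade_iff[OF assms(1)]]
  show X: "finite X" using T by blast
  show blocks: "B \<subseteq> X \<and> card B = k" if "B \<in> T i" "i \<in> {1..\<mu>}" for B i
    using T that by blast
  show "finite (T i)" if "i \<in> {1..\<mu>}" for i
    using blocks that X by (intro finite_subset[of "T i" "Pow X"]) blast+
  show "T i \<inter> T j = {}" if "i \<in> {1..\<mu>}" "j \<in> {1..\<mu>}" "i \<noteq> j" for i j
    using T that by blast
  show "card {B \<in> T i. S \<subseteq> B} = card {B \<in> T j. S \<subseteq> B}"
    if "i \<in> {1..\<mu>}" "j \<in> {1..\<mu>}" "S \<subseteq> X" "card S = t" for i j S
    using T that by blast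
qed

lemma sum_degrees:
  assumes "finite X" "finite A" "\<And>B. B \<in> A \<Longrightarrow> B \<subseteq> X \<and> card B = k"
  shows "(\<Sum>x\<in>X. card {B \<in> A. x \<in> B}) = k * card A"
proof (subst sum_multicount_gen[where k = "\<lambda>_. k"])
  show "\<forall>B\<in>A. card {x \<in> X. x \<in> B} = k"
  proof
    fix B assume "B \<in> A"
    then have "{x \<in> X. x \<in> B} = B" using assms(3) by blast
    with \<open>B \<in> A\<close> show "card {x \<in> X. x \<in> B} = k" using assms(3) by simp
  qed
qed (use assms in auto)

lemma sum_codegrees:
  assumes "finite X" "finite A" "\<And>B. B \<in> A \<Longrightarrow> B \<subseteq> X \<and> card B = 3"
  shows "(\<Sum>y\<in>X - {x}. card {B \<in> A. {x, y} \<subseteq> B}) = 2 * card {B \<in> A. x \<in> B}"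
proof -
  have eq: "{B \<in> A. {x, y} \<subseteq> B} = {B \<in> {B \<in> A. x \<in> B}. y \<in> B}" for y
    by auto
  show ?thesis unfolding eq
  proof (subst sum_multicount_gen[where k = "\<lambda>_. 2"])
    show "\<forall>B\<in>{B \<in> A. x \<in> B}. card {y \<in> X - {x}. y \<in> B} = 2"
    proof
      fix B assume B: "B \<in> {B \<in> A. x \<in> B}"
      then have "{y \<in> X - {x}. y \<in> B} = B - {x}" using assms(3) by blast
      then show "card {y \<in> X - {x}. y \<in> B} = 2"
        using B assms(3) by (simp add: card_Diff_singleton)
    qed
  qed (use assms in auto)
qed

text \<open>Balance descends by double counting: pair counts through \<open>x\<close> sum to twice
  the degree of \<open>x\<close>, and degrees sum to three times the volume.\<close>

lemma mu_way_trade_same_volume: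
  assumes \<mu>: "\<mu> \<ge> 2" and T: "is_mu_way_trade \<mu> v 3 2 X T"
    and i: "i \<in> {1..\<mu>}" and j: "j \<in> {1..\<mu>}"
  shows "card (T i) = card (T j)"
proof -
  note fX = mu_way_trade_finite_points[OF \<mu> T] and blocks = mu_way_trade_block[OF \<mu> T]
    and fin = mu_way_trade_finite[OF \<mu> T] and bal = mu_way_trade_balanced[OF \<mu> T]
  have "card {B \<in> T i. x \<in> B} = card {B \<in> T j. x \<in> B}" if "x \<in> X" for x
  proof -
    have "card {B \<in> T i. {x, y} \<subseteq> B} = card {B \<in> T j. {x, y} \<subseteq> B}" if "y \<in> X - {x}" for y
    proof -
      have "{x, y} \<subseteq> X" "card {x, y} = 2" using that \<open>x \<in> X\<close> by auto
      then show ?thesis by (rule bal[OF i j])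
    qed
    then have "2 * card {B \<in> T i. x \<in> B} = 2 * card {B \<in> T j. x \<in> B}"
      using sum_codegrees[OF fX fin[OF i] blocks[OF _ i], of x]
        sum_codegrees[OF fX fin[OF j] blocks[OF _ j], of x] by (metis (no_types, lifting) sum.cong)
    then show ?thesis by simp
  qed
  then have "3 * card (T i) = 3 * card (T j)"
    using sum_degrees[OF fX fin[OF i] blocks[OF _ i]] sum_degrees[OF fX fin[OF j] blocks[OF _ j]]
    by (metis (no_types, lifting) sum.cong)
  then show ?thesis by simp
qed

lemma mu_way_trade_triple:
  assumes "\<mu> \<ge> 2" and "is_mu_way_trade \<mu> v 3 2 X T" and "i \<in> {1..\<mu>}" and "{x, y, z} \<in> T i"
  shows "z \<in> X" "z \<noteq> x" "z \<noteq> y"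
  using mu_way_trade_block[OF assms(1,2,4,3)] by (auto simp: card_insert_if split: if_splits)

section \<open>Lower bound for the volume of a non-Steiner trade\<close>

text \<open>A block through \<open>x\<close> and \<open>y\<close> is determined by its third point.
  Disjointness of the collections makes the third points of different ways distinct, and balance
  gives each way equally many.\<close>

lemma card_third_points:
  assumes \<mu>: "\<mu> \<ge> 2" and T: "is_mu_way_trade \<mu> v 3 2 X T"
    and xy: "x \<in> X" "y \<in> X" "x \<noteq> y"
  shows "card {z. \<exists>i\<in>{1..\<mu>}. {x, y, z} \<in> T i} = \<mu> * card {B \<in> T 1. {x, y} \<subseteq> B}"
    (is "card ?Z = _")
proof -
  note fX = mu_way_trade_finite_points[OF \<mu> T] and blocks = mu_way_trade_block[OF \<mu> T]
    and fin = mu_way_trade_finite[OF \<mu> T] and bal = mu_way_trade_balanced[OF \<mu> T]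
  let ?U = "\<Union>i\<in>{1..\<mu>}. {B \<in> T i. {x, y} \<subseteq> B}"
  have new: "z \<notin> {x, y}" if "z \<in> ?Z" for z
    using that mu_way_trade_triple(2,3)[OF \<mu> T] by blast
  have "bij_betw (\<lambda>z. {x, y, z}) ?Z ?U"
  proof (rule bij_betwI')
    fix z z' assume "z \<in> ?Z" "z' \<in> ?Z"
    then show "({x, y, z} = {x, y, z'}) = (z = z')" using new by blast
  next
    fix z assume "z \<in> ?Z"
    then show "{x, y, z} \<in> ?U" by blast
  next
    fix B assume "B \<in> ?U"
    then obtain i where i: "i \<in> {1..\<mu>}" "B \<in> T i" "{x, y} \<subseteq> B" by blast
    then have "card (B - {x, y}) = 1"
      using blocks[of B i] xy by (subst card_Diff_subset) auto
    then obtain z where "B - {x, y} = {z}" by (auto simp: card_1_singleton_iff)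
    with i have "B = {x, y, z}" by blast
    with i show "\<exists>z\<in>?Z. B = {x, y, z}" by blast
  qed
  then have "card ?Z = card ?U" by (rule bij_betw_same_card)
  also have "card ?U = (\<Sum>i\<in>{1..\<mu>}. card {B \<in> T i. {x, y} \<subseteq> B})"
  proof (rule card_UN_disjoint)
    show "\<forall>i\<in>{1..\<mu>}. \<forall>j\<in>{1..\<mu>}. i \<noteq> j \<longrightarrow>
      {B \<in> T i. {x, y} \<subseteq> B} \<inter> {B \<in> T j. {x, y} \<subseteq> B} = {}"
      using mu_way_trade_disjoint[OF \<mu> T] by blast
  qed (use fin in auto)
  also have "\<dots> = (\<Sum>i\<in>{1..\<mu>}. card {B \<in> T 1. {x, y} \<subseteq> B})"
  proof (rule sum.cong)
    fix i assume i: "i \<in> {1..\<mu>}"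
    have "{x, y} \<subseteq> X" "card {x, y} = 2" "1 \<in> {1..\<mu>}" using xy \<mu> by auto
    then show "card {B \<in> T i. {x, y} \<subseteq> B} = card {B \<in> T 1. {x, y} \<subseteq> B}"
      using bal[OF i] by blast
  qed simp
  finally show ?thesis by simp
qed

text \<open>For each third point \<open>z\<close> of \<open>{x, y}\<close>, in whichever way, the
  pair \<open>{x, z}\<close> is covered in that way, hence by balance also in \<open>T 1\<close>.
  These points contribute \<mu> times the pair count of \<open>{x, y}\<close> to the sum of pair
  counts at \<open>x\<close>, and \<open>y\<close> itself contributes that count once more.\<close>

lemma degree_ge:
  assumes \<mu>: "\<mu> \<ge> 2" and T: "is_mu_way_trade \<mu> v 3 2 X T"
    and xy: "x \<in> X" "y \<in> X" "x \<noteq> y"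
  shows "(\<mu> + 1) * card {B \<in> T 1. {x, y} \<subseteq> B} \<le> 2 * card {B \<in> T 1. x \<in> B}"
proof -
  note fX = mu_way_trade_finite_points[OF \<mu> T] and blocks = mu_way_trade_block[OF \<mu> T]
    and fin = mu_way_trade_finite[OF \<mu> T] and bal = mu_way_trade_balanced[OF \<mu> T]
  have one: "1 \<in> {1..\<mu>}" using \<mu> by auto
  define Z where "Z = {z. \<exists>i\<in>{1..\<mu>}. {x, y, z} \<in> T i}"
  let ?l = "\<lambda>y. card {B \<in> T 1. {x, y} \<subseteq> B}"
  have Z: "z \<in> X - {x} - {y} \<and> ?l z \<ge> 1" if "z \<in> Z" for z
  proof -
    from that obtain i where i: "i \<in> {1..\<mu>}" "{x, y, z} \<in> T i" by (auto simp: Z_def)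
    note z = mu_way_trade_triple[OF \<mu> T i]
    have "finite {B \<in> T i. {x, z} \<subseteq> B}" using fin[OF i(1)] by simp
    moreover have "{x, y, z} \<in> {B \<in> T i. {x, z} \<subseteq> B}" using i by auto
    ultimately have "card {B \<in> T i. {x, z} \<subseteq> B} \<ge> 1"
      by (metis One_nat_def Suc_leI card_gt_0_iff empty_iff)
    moreover have "{x, z} \<subseteq> X" "card {x, z} = 2" using xy z by auto
    then have "card {B \<in> T i. {x, z} \<subseteq> B} = ?l z" by (rule bal[OF i(1) one])
    ultimately show ?thesis using z by auto
  qed
  have finZ: "finite Z" by (rule finite_subset[of _ X]) (use Z fX in auto)
  have "\<mu> * ?l y = card Z" using card_third_points[OF \<mu> T xy] by (simp add: Z_def)
  also have "\<dots> = (\<Sum>z\<in>Z. 1)" by simp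
  also have "\<dots> \<le> (\<Sum>z\<in>Z. ?l z)" using Z by (intro sum_mono) auto
  finally have "(\<mu> + 1) * ?l y \<le> ?l y + (\<Sum>z\<in>Z. ?l z)" by simp
  also have "\<dots> = (\<Sum>z\<in>insert y Z. ?l z)"
    using finZ Z by (subst sum.insert) auto
  also have "\<dots> \<le> (\<Sum>z\<in>X - {x}. ?l z)"
    using fX Z xy by (intro sum_mono2) auto
  also have "\<dots> = 2 * card {B \<in> T 1. x \<in> B}"
    by (rule sum_codegrees[OF fX fin[OF one] blocks[OF _ one]])
  finally show ?thesis .
qed

text \<open>Sums degrees over a doubly covered pair and its third points, of which there are at
  least 2\<mu>. The factor \<open>\<mu> div 2 + 1\<close> is (\<mu> + 1)/2 rounded up.\<close>

lemma non_steiner_volume_ge: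
  assumes \<mu>: "\<mu> \<ge> 2" and T: "is_mu_way_trade \<mu> v 3 2 X T" and ns: "\<not> is_steiner \<mu> 2 X T"
  shows "2 * (\<mu> + 1) + 2 * \<mu> * (\<mu> div 2 + 1) \<le> 3 * card (T 1)"
proof -
  note fX = mu_way_trade_finite_points[OF \<mu> T] and blocks = mu_way_trade_block[OF \<mu> T]
    and fin = mu_way_trade_finite[OF \<mu> T] and bal = mu_way_trade_balanced[OF \<mu> T]
  have one: "1 \<in> {1..\<mu>}" using \<mu> by auto
  let ?r = "\<lambda>x. card {B \<in> T 1. x \<in> B}"
  from ns obtain S i where S: "S \<subseteq> X" "card S = 2" "i \<in> {1..\<mu>}" "card {B \<in> T i. S \<subseteq> B} > 1"
    by (auto simp: is_steiner_def not_le)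
  then have S1: "card {B \<in> T 1. S \<subseteq> B} \<ge> 2" using bal[OF S(3) one S(1,2)] by simp
  from S obtain x y where xy: "S = {x, y}" "x \<noteq> y" by (auto simp: card_2_iff)
  with S have xyX: "x \<in> X" "y \<in> X" by auto
  define Z where "Z = {z. \<exists>i\<in>{1..\<mu>}. {x, y, z} \<in> T i}"
  have rx: "?r x \<ge> \<mu> + 1"
  proof -
    have "2 * (\<mu> + 1) \<le> (\<mu> + 1) * card {B \<in> T 1. {x, y} \<subseteq> B}"
      using S1 xy by (metis mult.commute mult_le_mono2)
    from order_trans[OF this degree_ge[OF \<mu> T xyX xy(2)]] show ?thesis by simp
  qed
  have ry: "?r y \<ge> \<mu> + 1"
  proof -
    have "2 * (\<mu> + 1) \<le> (\<mu> + 1) * card {B \<in> T 1. {y, x} \<subseteq> B}"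
      using S1 xy by (metis mult.commute mult_le_mono2 insert_commute)
    from order_trans[OF this degree_ge[OF \<mu> T xyX(2) xyX(1) xy(2)[symmetric]]]
    show ?thesis by simp
  qed
  have Z: "z \<in> X - {x, y} \<and> ?r z \<ge> \<mu> div 2 + 1" if "z \<in> Z" for z
  proof -
    from that obtain i where i: "i \<in> {1..\<mu>}" "{x, y, z} \<in> T i" by (auto simp: Z_def)
    note z = mu_way_trade_triple[OF \<mu> T i]
    \<comment> \<open>The pair \<open>{z, x}\<close> is covered at least once, so
      \<open>degree_ge\<close> can be applied with \<open>z\<close> as the centre.\<close>
    have "{x, y, z} \<in> {B \<in> T i. {z, x} \<subseteq> B}" using i by auto
    moreover have "finite {B \<in> T i. {z, x} \<subseteq> B}" using fin[OF i(1)] by simp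
    ultimately have "card {B \<in> T i. {z, x} \<subseteq> B} \<ge> 1"
      by (metis One_nat_def Suc_leI card_gt_0_iff empty_iff)
    moreover have "{z, x} \<subseteq> X" "card {z, x} = 2" using xyX z by auto
    then have "card {B \<in> T i. {z, x} \<subseteq> B} = card {B \<in> T 1. {z, x} \<subseteq> B}"
      by (rule bal[OF i(1) one])
    ultimately have "1 \<le> card {B \<in> T 1. {z, x} \<subseteq> B}" by linarith
    then have "\<mu> + 1 \<le> (\<mu> + 1) * card {B \<in> T 1. {z, x} \<subseteq> B}"
      using mult_le_mono2[of 1 _ "\<mu> + 1"] by simp
    from order_trans[OF this degree_ge[OF \<mu> T z(1) xyX(1) z(2)]] have "\<mu> + 1 \<le> 2 * ?r z" .
    with z show ?thesis by auto
  qed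
  have finZ: "finite Z" by (rule finite_subset[of _ X]) (use Z fX in auto)
  have "card Z = \<mu> * card {B \<in> T 1. {x, y} \<subseteq> B}"
    using card_third_points[OF \<mu> T xyX xy(2)] by (simp add: Z_def)
  then have "2 * \<mu> \<le> card Z" using S1 xy by simp
  then have "2 * \<mu> * (\<mu> div 2 + 1) \<le> card Z * (\<mu> div 2 + 1)" by (rule mult_le_mono1)
  also have "\<dots> = (\<Sum>z\<in>Z. \<mu> div 2 + 1)" by simp
  also have "\<dots> \<le> (\<Sum>z\<in>Z. ?r z)" using Z by (intro sum_mono) auto
  finally have rZ: "2 * \<mu> * (\<mu> div 2 + 1) \<le> (\<Sum>z\<in>Z. ?r z)" .
  have "2 * (\<mu> + 1) \<le> ?r x + ?r y" using rx ry by simp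
  from add_mono[OF this rZ]
  have "2 * (\<mu> + 1) + 2 * \<mu> * (\<mu> div 2 + 1) \<le> (?r x + ?r y) + (\<Sum>z\<in>Z. ?r z)" .
  also have "\<dots> = (\<Sum>z\<in>insert x (insert y Z). ?r z)"
  proof -
    have "x \<notin> insert y Z" "y \<notin> Z" using Z xy(2) by auto
    then show ?thesis using finZ by simp
  qed
  also have "\<dots> \<le> (\<Sum>z\<in>X. ?r z)"
    using fX Z xyX by (intro sum_mono2) auto
  also have "\<dots> = 3 * card (T 1)"
    by (rule sum_degrees[OF fX fin[OF one] blocks[OF _ one]])
  finally show ?thesis .
qed

text \<open>The first \<mu> ways of an \<open>n\<close>-way trade form a \<mu>-way trade, so a
  construction for one \<open>n\<close> serves every smaller \<mu>.\<close>

lemma min_volume_le: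
  fixes X :: "nat set"
  assumes \<mu>: "2 \<le> \<mu>" and n: "\<mu> \<le> n" and T: "is_mu_way_trade n v 3 2 X T"
    and w: "card (T 1) \<le> w"
  shows "min_volume \<mu> 3 2 \<le> w"
proof -
  have T\<mu>: "is_mu_way_trade \<mu> v 3 2 X T"
    using T n by (auto simp: is_mu_way_trade_def)
  have "has_volume \<mu> T (card (T 1))"
    unfolding has_volume_def
  proof
    fix i assume "i \<in> {1..\<mu>}"
    then show "card (T i) = card (T 1)"
      by (rule mu_way_trade_same_volume[OF \<mu> T\<mu>]) (use \<mu> in auto)
  qed
  with T\<mu> have "min_volume \<mu> 3 2 \<le> card (T 1)"
    unfolding min_volume_def by (intro Least_le exI conjI)
  with w show ?thesis by simp
qed


section \<open>Trades from the rotations of a base\<close>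

definition rot :: "nat \<Rightarrow> nat \<Rightarrow> nat" where
  "rot n p = (if p < n then if Suc p = n then 0 else Suc p else p)"

text \<open>Increasing triples serve as canonical forms of 3-sets, so that the conditions on a base
  can be checked by evaluation.\<close>

fun sort3 :: "nat \<times> nat \<times> nat \<Rightarrow> nat \<times> nat \<times> nat" where
  "sort3 (a, b, c) =
     (if a < b then if b < c then (a, b, c) else if a < c then (a, c, b) else (c, a, b)
      else if a < c then (b, a, c) else if b < c then (b, c, a) else (c, b, a))"

fun rot3 :: "nat \<Rightarrow> nat \<times> nat \<times> nat \<Rightarrow> nat \<times> nat \<times> nat" where
  "rot3 n (a, b, c) = sort3 (rot n a, rot n b, rot n c)"

fun pairs3 :: "nat \<times> nat \<times> nat \<Rightarrow> (nat \<times> nat) list" where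
  "pairs3 (a, b, c) = [(a, b), (a, c), (b, c)]"

fun incr3 :: "nat \<times> nat \<times> nat \<Rightarrow> bool" where
  "incr3 (a, b, c) \<longleftrightarrow> a < b \<and> b < c"

fun set3 :: "nat \<times> nat \<times> nat \<Rightarrow> nat set" where
  "set3 (a, b, c) = {a, b, c}"

text \<open>\<open>D\<close> covers every pair at most once, the set of covered pairs is invariant under the rotation
  of the points \<open>0, \<dots>, n - 1\<close>, and no rotation maps a triple of \<open>D\<close> into \<open>D\<close>. Then the \<open>n\<close>
  rotated copies of \<open>D\<close> form an \<open>n\<close>-way trade.\<close>

definition rotation_base :: "nat \<Rightarrow> (nat \<times> nat \<times> nat) list \<Rightarrow> bool" where
  "rotation_base n D \<longleftrightarrow> D \<noteq> [] \<and> (\<forall>t\<in>set D. incr3 t) \<and>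
     distinct (concat (map pairs3 D)) \<and>
     (\<forall>(a, b)\<in>set (concat (map pairs3 D)).
        (min (rot n a) (rot n b), max (rot n a) (rot n b)) \<in> set (concat (map pairs3 D))) \<and>
     (\<forall>k\<in>{1..<n}. \<forall>t\<in>set D. (rot3 n ^^ k) t \<notin> set D)"

lemma inj_rot: "inj (rot n)"
  by (auto simp: inj_def rot_def split: if_splits)

lemma set3_rot3: "set3 (rot3 n t) = rot n ` set3 t"
  by (cases t) auto

lemma incr3_rot3:
  assumes "incr3 t"
  shows "incr3 (rot3 n t)"
proof -
  obtain a b c where t: "t = (a, b, c)" by (cases t)
  have "rot n a \<noteq> rot n b" "rot n a \<noteq> rot n c" "rot n b \<noteq> rot n c"
    using assms t by (auto dest: injD[OF inj_rot])
  then show ?thesis by (auto simp: t)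
qed

lemma set3_rot3_funpow: "set3 ((rot3 n ^^ k) t) = (rot n ^^ k) ` set3 t"
  by (induction k) (auto simp: set3_rot3)

lemma incr3_rot3_funpow: "incr3 t \<Longrightarrow> incr3 ((rot3 n ^^ k) t)"
  by (induction k) (auto simp: incr3_rot3)

lemma set3_inject:
  assumes "incr3 s" "incr3 t" "set3 s = set3 t"
  shows "s = t"
proof -
  obtain a b c d e f where st: "s = (a, b, c)" "t = (d, e, f)" by (cases s, cases t)
  have "sorted_list_of_set {a, b, c} = [a, b, c]" "sorted_list_of_set {d, e, f} = [d, e, f]"
    using assms(1,2) unfolding st by simp_all
  moreover have "{a, b, c} = {d, e, f}" using assms(3) st by simp
  ultimately have "[a, b, c] = [d, e, f]" by metis
  then show ?thesis using st by simp
qed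

lemma pair_subset_set3:
  assumes "incr3 t" "p < q"
  shows "{p, q} \<subseteq> set3 t \<longleftrightarrow> (p, q) \<in> set (pairs3 t)"
  using assms by (cases t) auto

lemma card_set3: "incr3 t \<Longrightarrow> card (set3 t) = 3"
  by (cases t) auto

lemma card_cover_image:
  assumes "inj f"
  shows "card {B \<in> image f ` A. f ` R \<subseteq> B} = card {B \<in> A. R \<subseteq> B}"
proof -
  have "{B \<in> image f ` A. f ` R \<subseteq> B} = image f ` {B \<in> A. R \<subseteq> B}"
    using inj_image_subset_iff[OF assms] by auto
  moreover have "inj_on (image f) {B \<in> A. R \<subseteq> B}"
    using inj_image_eq_iff[OF assms] by (auto simp: inj_on_def)
  ultimately show ?thesis by (simp add: card_image)
qed

text \<open>The right-hand side does not depend on \<open>i\<close>, which is the balance condition.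
  For \<open>i = 0\<close>, distinctness of the listed pairs puts each pair in at most one triple;
  further rotations preserve the count because the set of covered pairs is rotation
  invariant.\<close>

lemma rotation_base_cover:
  assumes base: "rotation_base n D" and S: "card S = 2"
  shows "card {B \<in> (\<lambda>B. (rot n ^^ i) ` B) ` set3 ` set D. S \<subseteq> B} =
    (if S \<in> (\<lambda>(p, q). {p, q}) ` set (concat (map pairs3 D)) then 1 else 0)"
  using S
proof (induction i arbitrary: S)
  case 0
  have incr: "incr3 t" if "t \<in> set D" for t using base that by (auto simp: rotation_base_def)
  from 0 obtain p q where pq: "S = {p, q}" "p < q"
    by (auto simp: card_2_iff) (metis insert_commute linorder_neqE_nat)
  have sub: "S \<subseteq> set3 t \<longleftrightarrow> (p, q) \<in> set (pairs3 t)" if "t \<in> set D" for t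
    using pair_subset_set3[OF incr[OF that] pq(2)] pq by simp
  have E: "S \<in> (\<lambda>(p, q). {p, q}) ` set (concat (map pairs3 D)) \<longleftrightarrow> (\<exists>t\<in>set D. S \<subseteq> set3 t)"
  proof
    assume "S \<in> (\<lambda>(p, q). {p, q}) ` set (concat (map pairs3 D))"
    then obtain a b t where "S = {a, b}" "t \<in> set D" "(a, b) \<in> set (pairs3 t)" by auto
    then show "\<exists>t\<in>set D. S \<subseteq> set3 t" by (intro bexI[of _ t]) (cases t; auto)+
  next
    assume "\<exists>t\<in>set D. S \<subseteq> set3 t"
    then have "(p, q) \<in> set (concat (map pairs3 D))" using sub by auto
    then show "S \<in> (\<lambda>(p, q). {p, q}) ` set (concat (map pairs3 D))"
      unfolding pq(1) by (rule rev_image_eqI) simp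
  qed
  have uniq: "s = t" if "s \<in> set D" "t \<in> set D" "S \<subseteq> set3 s" "S \<subseteq> set3 t" for s t
  proof -
    have "distinct (concat (map pairs3 D))" using base by (simp add: rotation_base_def)
    then have "set (pairs3 s) \<inter> set (pairs3 t) = {}" if "pairs3 s \<noteq> pairs3 t"
      using that \<open>s \<in> set D\<close> \<open>t \<in> set D\<close> unfolding distinct_concat_iff by simp
    moreover have "(p, q) \<in> set (pairs3 s) \<inter> set (pairs3 t)" using sub that by simp
    ultimately have "pairs3 s = pairs3 t" by blast
    then show ?thesis by (cases s; cases t) auto
  qed
  show ?case
  proof (cases "\<exists>t\<in>set D. S \<subseteq> set3 t")
    case True
    then obtain t where t: "t \<in> set D" "S \<subseteq> set3 t" by blast
    have "{B \<in> (\<lambda>B. (rot n ^^ 0) ` B) ` set3 ` set D. S \<subseteq> B} = set3 ` {s \<in> set D. S \<subseteq> set3 s}"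
      by auto
    also have "{s \<in> set D. S \<subseteq> set3 s} = {t}"
      using uniq t by blast
    finally have "{B \<in> (\<lambda>B. (rot n ^^ 0) ` B) ` set3 ` set D. S \<subseteq> B} = {set3 t}"
      by simp
    then show ?thesis using True E by simp
  next
    case False
    then have "{B \<in> (\<lambda>B. (rot n ^^ 0) ` B) ` set3 ` set D. S \<subseteq> B} = {}" by auto
    then show ?thesis using False E by (simp only: card.empty if_False)
  qed
next
  case (Suc i)
  define A where "A = (\<lambda>B. (rot n ^^ i) ` B) ` set3 ` set D"
  define E where "E = (\<lambda>(p, q). {p, q}) ` set (concat (map pairs3 D))"
  have inj: "inj (image (rot n))" using inj_rot by (simp add: inj_image_eq_iff inj_def)
  have "image (rot n) ` E \<subseteq> E"
  proof
    fix R assume "R \<in> image (rot n) ` E"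
    then obtain a b where ab: "R = {rot n a, rot n b}" "(a, b) \<in> set (concat (map pairs3 D))"
      by (auto simp: E_def)
    with base have "(min (rot n a) (rot n b), max (rot n a) (rot n b)) \<in> set (concat (map pairs3 D))"
      unfolding rotation_base_def by blast
    then show "R \<in> E"
      unfolding E_def by (rule rev_image_eqI) (auto simp: ab min_def max_def)
  qed
  \<comment> \<open>An injective map of a finite set into itself is onto.\<close>
  then have rotE: "image (rot n) ` E = E"
    by (intro endo_inj_surj inj_on_subset[OF inj]) (auto simp: E_def)
  have "(\<lambda>B. (rot n ^^ Suc i) ` B) ` set3 ` set D = image (rot n) ` A"
    by (simp add: A_def image_image)
  moreover have "card {B \<in> image (rot n) ` A. S \<subseteq> B} = (if S \<in> E then 1 else 0)"
  \<comment> \<open>This split makes injectivity of \<open>rot n\<close> suffice: a pair outside the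
    range lies in no rotated block, and by \<open>rotE\<close> not in \<open>E\<close>
    either.\<close>
  proof (cases "S \<subseteq> range (rot n)")
    case True
    then obtain R where R: "S = rot n ` R" by (auto simp: subset_image_iff)
    have "card R = 2" using Suc.prems card_image[OF inj_on_subset[OF inj_rot]] R by force
    have "card {B \<in> image (rot n) ` A. S \<subseteq> B} = card {B \<in> A. R \<subseteq> B}"
      unfolding R by (rule card_cover_image[OF inj_rot])
    also have "\<dots> = (if R \<in> E then 1 else 0)"
      using Suc.IH[OF \<open>card R = 2\<close>] unfolding A_def E_def .
    also have "R \<in> E \<longleftrightarrow> S \<in> E"
      using inj_image_mem_iff[OF inj, of R E] unfolding rotE R by simp
    finally show ?thesis .
  next
    case False
    then have "{B \<in> image (rot n) ` A. S \<subseteq> B} = {}" by blast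
    moreover have "S \<notin> image (rot n) ` E" using False by blast
    ultimately show ?thesis unfolding rotE by (simp only: card.empty if_False)
  qed
  ultimately show ?case unfolding E_def by simp
qed

text \<open>A block common to the copies \<open>i < j\<close> would, after cancelling
  \<open>i\<close> rotations, give a triple of \<open>D\<close> that \<open>j - i\<close> rotations
  carry into \<open>D\<close>, with \<open>j - i\<close> between 1 and \<open>n - 1\<close>.\<close>

lemma rotation_base_trade:
  assumes base: "rotation_base n D"
  shows "\<exists>v X. is_mu_way_trade n v 3 2 X (\<lambda>i. (\<lambda>B. (rot n ^^ i) ` B) ` set3 ` set D)"
proof -
  let ?T = "\<lambda>i. (\<lambda>B. (rot n ^^ i) ` B) ` set3 ` set D"
  \<comment> \<open>Including \<open>{..<n}\<close> makes \<open>X\<close> closed under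
    rotation.\<close>
  define X where "X = {..<n} \<union> (\<Union>t\<in>set D. set3 t)"
  have incr: "incr3 t" if "t \<in> set D" for t using base that by (auto simp: rotation_base_def)
  have "finite (set3 t)" for t by (cases t) auto
  then have fX: "finite X" by (auto simp: X_def)
  have rotX: "rot n ` X \<subseteq> X" by (auto simp: X_def rot_def)
  have rotiX: "(rot n ^^ i) ` X \<subseteq> X" for i
    by (induction i) (use rotX in auto)
  have ne: "?T i \<noteq> {}" for i using base by (auto simp: rotation_base_def)
  have blocks: "B \<subseteq> X \<and> card B = 3" if "B \<in> ?T i" for B i
  proof -
    from that obtain t where t: "t \<in> set D" "B = (rot n ^^ i) ` set3 t" by auto
    have "set3 t \<subseteq> X" using t by (auto simp: X_def)
    then have "B \<subseteq> X" using rotiX[of i] t by blast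
    moreover have "card B = card (set3 t)"
      using t(2) card_image[OF inj_on_subset[OF inj_fn[OF inj_rot]]] by blast
    ultimately show ?thesis using card_set3[OF incr[OF t(1)]] by simp
  qed
  have less: "?T i \<inter> ?T j = {}" if "1 \<le> i" "i < j" "j \<le> n" for i j
  proof (rule ccontr)
    assume "?T i \<inter> ?T j \<noteq> {}"
    then obtain s t where st: "s \<in> set D" "t \<in> set D"
      "(rot n ^^ i) ` set3 s = (rot n ^^ j) ` set3 t" by auto
    have "(rot n ^^ j) ` set3 t = (rot n ^^ i) ` (rot n ^^ (j - i)) ` set3 t"
      using funpow_add[of i "j - i" "rot n"] that by (simp add: image_comp)
    with st have "set3 s = (rot n ^^ (j - i)) ` set3 t"
      by (simp add: inj_image_eq_iff[OF inj_fn[OF inj_rot]])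
    then have "s = (rot3 n ^^ (j - i)) t"
      using st incr by (intro set3_inject) (auto simp: set3_rot3_funpow incr3_rot3_funpow)
    moreover have "j - i \<in> {1..<n}" using that by auto
    ultimately show False using base st by (auto simp: rotation_base_def)
  qed
  have disj: "?T i \<inter> ?T j = {}" if "i \<in> {1..n}" "j \<in> {1..n}" "i \<noteq> j" for i j
    using less[of i j] less[of j i] that by (cases "i < j") (auto simp: Int_commute)
  have "is_trade (card X) 3 2 X (?T i) (?T j)" if "i \<in> {1..n}" "j \<in> {1..n}" "i \<noteq> j" for i j
    unfolding is_trade_def
  proof (intro conjI)
    show "\<forall>S. S \<subseteq> X \<and> card S = 2 \<longrightarrow> card {B \<in> ?T i. S \<subseteq> B} = card {B \<in> ?T j. S \<subseteq> B}"
      using rotation_base_cover[OF base] by simp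
  qed (use fX ne blocks disj[OF that] in blast)+
  then show ?thesis unfolding is_mu_way_trade_def by blast
qed

section \<open>Explicit bases\<close>

text \<open>Found by computer search. The rotations of \<open>base7\<close>, \<open>base11\<close> and \<open>base17\<close> are large sets of
  disjoint Steiner triple systems of orders 9, 13 and 19, those of \<open>base4\<close> are disjoint group
  divisible designs of type \<open>2\<^sup>4\<close>, and \<open>base3\<close> joins three points to the one-factors
  of \<open>K\<^sub>4\<close>.\<close>

definition base3 :: "(nat \<times> nat \<times> nat) list" where "base3 =
  [(0,1,4),(0,2,6),(0,3,5),(1,2,5),(1,3,6),(2,3,4)]"

definition base4 :: "(nat \<times> nat \<times> nat) list" where "base4 =
  [(0,1,6),(0,3,5),(0,4,7),(1,2,4),(1,5,7),(2,3,7),(2,5,6),(3,4,6)]"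

definition base7 :: "(nat \<times> nat \<times> nat) list" where "base7 =
  [(0,1,5),(0,2,4),(0,3,7),(0,6,8),(1,2,3),(1,4,8),(1,6,7),(2,5,6),(2,7,8),(3,4,6),(3,5,8),
   (4,5,7)]"

definition base11 :: "(nat \<times> nat \<times> nat) list" where "base11 =
  [(0,1,3),(0,2,11),(0,4,12),(0,5,9),(0,6,7),(0,8,10),(1,2,9),(1,4,6),(1,5,10),(1,7,12),
   (1,8,11),(2,3,8),(2,4,7),(2,5,12),(2,6,10),(3,4,10),(3,5,7),(3,6,9),(3,11,12),(4,5,8),
   (4,9,11),(5,6,11),(6,8,12),(7,8,9),(7,10,11),(9,10,12)]"

definition base17 :: "(nat \<times> nat \<times> nat) list" where "base17 =
  [(0,1,16),(0,2,15),(0,3,14),(0,4,13),(0,5,12),(0,6,11),(0,7,10),(0,8,9),(0,17,18),(1,2,8),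
   (1,3,6),(1,4,9),(1,5,17),(1,7,18),(1,10,12),(1,11,13),(1,14,15),(2,3,16),(2,4,18),(2,5,9),
   (2,6,12),(2,7,11),(2,10,13),(2,14,17),(3,4,8),(3,5,13),(3,7,9),(3,10,11),(3,12,17),
   (3,15,18),(4,5,10),(4,6,16),(4,7,15),(4,11,17),(4,12,14),(5,6,8),(5,7,16),(5,11,15),
   (5,14,18),(6,7,14),(6,9,17),(6,10,15),(6,13,18),(7,8,17),(7,12,13),(8,10,14),(8,11,18),
   (8,12,15),(8,13,16),(9,10,18),(9,11,12),(9,13,14),(9,15,16),(10,16,17),(11,14,16),
   (12,16,18),(13,15,17)]"

lemma rotation_base3: "rotation_base 3 base3"
  by code_simp

lemma length_base3: "length base3 = 6"
  by (simp add: base3_def)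

lemma rotation_base4: "rotation_base 4 base4"
  by code_simp

lemma length_base4: "length base4 = 8"
  by (simp add: base4_def)

lemma rotation_base7: "rotation_base 7 base7"
  by code_simp

lemma length_base7: "length base7 = 12"
  by (simp add: base7_def)

lemma rotation_base11: "rotation_base 11 base11"
  by code_simp

lemma length_base11: "length base11 = 26"
  by (simp add: base11_def)

lemma rotation_base17: "rotation_base 17 base17"
  by code_simp

lemma length_base17: "length base17 = 57"
  by (simp add: base17_def)

section \<open>Blowing up a trade by Latin squares\<close>

text \<open>A natural number \<open>p\<close> stands for the copy \<open>p mod g\<close> of the point \<open>p div g\<close>. Two points of a
  block together with the prescribed sum of the residues determine the third one, so a pair of
  copies of distinct points is covered exactly as often as the pair of points itself.\<close>

definition blow_up :: "nat \<Rightarrow> nat \<Rightarrow> nat set set \<Rightarrow> nat set set" where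
  "blow_up g j A = {B. card B = 3 \<and> (\<lambda>p. p div g) ` B \<in> A \<and> \<Sum>B mod g = j}"

text \<open>Modulo \<open>g\<close>, the term \<open>(g - 1) * s\<close> stands for -s and avoids
  truncated subtraction.\<close>

lemma mod_solve_add:
  fixes g j r s :: nat
  assumes "0 < g" "(r + s) mod g = j"
  shows "r mod g = (j + (g - 1) * s) mod g"
proof -
  have "(j + (g - 1) * s) mod g = (r + s + (g - 1) * s) mod g"
    using assms(2) by (metis mod_add_left_eq)
  also have "r + s + (g - 1) * s = r + g * s"
    using assms(1) by (cases g) auto
  finally show ?thesis by simp
qed

lemma mod_add_solution:
  fixes g j s :: nat
  assumes "j < g"
  shows "((j + (g - 1) * s) mod g + s) mod g = j"
proof -
  have "((j + (g - 1) * s) mod g + s) mod g = (j + (g - 1) * s + s) mod g"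
    by (rule mod_add_left_eq)
  also have "j + (g - 1) * s + s = j + g * s"
    using assms by (cases g) auto
  finally show ?thesis using assms by simp
qed

text \<open>Projection is a bijection between the blocks through \<open>S\<close> and the blocks of
  \<open>A\<close> through its image: the missing point lies over a known point, and the sum
  condition fixes its residue. The count is therefore independent of \<open>j\<close>.\<close>

lemma card_blow_up_cover:
  assumes A: "\<And>C. C \<in> A \<Longrightarrow> card C = 3" and j: "j < g"
    and S: "card S = 2" "card ((\<lambda>p. p div g) ` S) = 2"
  shows "card {B \<in> blow_up g j A. S \<subseteq> B} = card {C \<in> A. (\<lambda>p. p div g) ` S \<subseteq> C}"
proof -
  let ?\<pi> = "\<lambda>p::nat. p div g"
  have g: "g > 0" using j by simp
  have finS: "finite S" using S by (metis card.infinite zero_neq_numeral)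
  have split: "\<exists>p. p \<notin> S \<and> B = insert p S \<and> ?\<pi> p \<notin> ?\<pi> ` S \<and> (p + \<Sum>S) mod g = j"
    if "B \<in> blow_up g j A" "S \<subseteq> B" for B
  proof -
    have B: "card B = 3" "?\<pi> ` B \<in> A" "\<Sum>B mod g = j" using that by (auto simp: blow_up_def)
    then have "card (B - S) = 1" using S finS that by (simp add: card_Diff_subset)
    then obtain p where "B - S = {p}" by (auto simp: card_1_singleton_iff)
    then have p: "p \<notin> S" "B = insert p S" using that by blast+
    have "card (insert (?\<pi> p) (?\<pi> ` S)) = 3" using A[OF B(2)] p by simp
    then have "?\<pi> p \<notin> ?\<pi> ` S" using S by (auto simp: insert_absorb)
    moreover have "(p + \<Sum>S) mod g = j" using B p finS by simp
    ultimately show ?thesis using p by blast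
  qed
  have "bij_betw (image ?\<pi>) {B \<in> blow_up g j A. S \<subseteq> B} {C \<in> A. ?\<pi> ` S \<subseteq> C}"
  proof (rule bij_betwI')
    fix B B' assume "B \<in> {B \<in> blow_up g j A. S \<subseteq> B}" "B' \<in> {B \<in> blow_up g j A. S \<subseteq> B}"
    then obtain p p' where p: "B = insert p S" "?\<pi> p \<notin> ?\<pi> ` S" "(p + \<Sum>S) mod g = j"
      and p': "B' = insert p' S" "?\<pi> p' \<notin> ?\<pi> ` S" "(p' + \<Sum>S) mod g = j"
      using split by (metis (no_types, lifting) mem_Collect_eq)
    have "p mod g = p' mod g" using mod_solve_add[OF g p(3)] mod_solve_add[OF g p'(3)] by simp
    moreover have "?\<pi> p = ?\<pi> p'" if "?\<pi> ` B = ?\<pi> ` B'"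
    proof -
      have "insert (?\<pi> p) (?\<pi> ` S) = insert (?\<pi> p') (?\<pi> ` S)" using that p p' by simp
      then show ?thesis using p(2) p'(2) by blast
    qed
    ultimately have "p = p'" if "?\<pi> ` B = ?\<pi> ` B'"
      using that by (metis div_mult_mod_eq)
    then show "(?\<pi> ` B = ?\<pi> ` B') = (B = B')" using p p' by blast
  next
    fix B assume "B \<in> {B \<in> blow_up g j A. S \<subseteq> B}"
    then show "?\<pi> ` B \<in> {C \<in> A. ?\<pi> ` S \<subseteq> C}" by (auto simp: blow_up_def)
  next
    fix C assume C: "C \<in> {C \<in> A. ?\<pi> ` S \<subseteq> C}"
    then have "card (C - ?\<pi> ` S) = 1" using A[of C] S finS by (simp add: card_Diff_subset)
    then obtain c where "C - ?\<pi> ` S = {c}" by (auto simp: card_1_singleton_iff)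
    then have c: "C = insert c (?\<pi> ` S)" "c \<notin> ?\<pi> ` S" using C by blast+
    \<comment> \<open>The copy of \<open>c\<close> whose residue is \<open>j\<close> minus the sum
      of \<open>S\<close>, modulo \<open>g\<close>.\<close>
    define p where "p = g * c + (j + (g - 1) * \<Sum>S) mod g"
    have pc: "?\<pi> p = c" using g by (simp add: p_def)
    then have "p \<notin> S" using c by blast
    moreover have "(p + \<Sum>S) mod g = j"
      using mod_add_solution[OF j, of "\<Sum>S"] by (simp add: p_def add.assoc)
    ultimately have "insert p S \<in> {B \<in> blow_up g j A. S \<subseteq> B}"
      using C c pc S finS by (auto simp: blow_up_def)
    moreover have "C = ?\<pi> ` insert p S" using c pc by simp
    ultimately show "\<exists>B\<in>{B \<in> blow_up g j A. S \<subseteq> B}. C = ?\<pi> ` B" by blast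
  qed
  then show ?thesis by (rule bij_betw_same_card)
qed

text \<open>A block and its projection both have three points, so projection is injective on the
  block and two copies of one point never occur together.\<close>

lemma blow_up_cover_empty:
  assumes A: "\<And>C. C \<in> A \<Longrightarrow> card C = 3"
    and S: "card S = 2" "card ((\<lambda>p. p div g) ` S) \<noteq> 2"
  shows "{B \<in> blow_up g j A. S \<subseteq> B} = {}"
proof -
  have False if B: "B \<in> blow_up g j A" "S \<subseteq> B" for B
  proof -
    have "card B = 3" "card ((\<lambda>p. p div g) ` B) = 3" using B A by (auto simp: blow_up_def)
    then have "inj_on (\<lambda>p. p div g) B"
      by (intro eq_card_imp_inj_on) (auto intro: card_ge_0_finite)
    then have "card ((\<lambda>p. p div g) ` S) = card S" using B by (metis card_image inj_on_subset)
    then show False using S by simp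
  qed
  then show ?thesis by blast
qed

text \<open>Over a block \<open>{a, b, c}\<close>, the copies of \<open>a\<close> and
  \<open>b\<close> determine the copy of \<open>c\<close>, which leaves at most
  \<open>g\<^sup>2\<close> choices.\<close>

lemma card_blow_up_le:
  assumes fin: "finite A" and A: "\<And>C. C \<in> A \<Longrightarrow> card C = 3" and g: "0 < g"
  shows "card (blow_up g j A) \<le> card A * g\<^sup>2"
proof -
  let ?\<pi> = "\<lambda>p::nat. p div g"
  let ?F = "\<lambda>C. {B \<in> blow_up g j A. ?\<pi> ` B = C}"
  have F: "finite (?F C) \<and> card (?F C) \<le> g\<^sup>2" if CA: "C \<in> A" for C
  proof -
    obtain a b c where C: "C = {a, b, c}" "a \<noteq> b" "a \<noteq> c" "b \<noteq> c"
      using A[OF CA] by (auto simp: card_3_iff)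
    let ?f = "\<lambda>(p, q). {p, q, g * c + (j + (g - 1) * (p + q)) mod g}"
    let ?R = "{g * a..<g * a + g} \<times> {g * b..<g * b + g}"
    have sub: "?F C \<subseteq> ?f ` ?R"
    proof
      fix B assume "B \<in> ?F C"
      then have B: "card B = 3" "?\<pi> ` B = {a, b, c}" "\<Sum>B mod g = j"
        using C by (auto simp: blow_up_def)
      have "a \<in> ?\<pi> ` B" "b \<in> ?\<pi> ` B" "c \<in> ?\<pi> ` B" unfolding B(2) by simp_all
      then obtain p q r where pqr: "p \<in> B" "q \<in> B" "r \<in> B" "?\<pi> p = a" "?\<pi> q = b" "?\<pi> r = c"
        by (auto elim!: imageE)
      then have ne: "p \<noteq> q" "p \<noteq> r" "q \<noteq> r" using C by auto
      then have "card {p, q, r} = card B" using B by simp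
      then have Beq: "B = {p, q, r}"
        using B pqr by (metis card_subset_eq card.infinite empty_subsetI insert_subset zero_neq_numeral)
      then have "(r + (p + q)) mod g = j" using B ne by (simp add: ac_simps)
      from mod_solve_add[OF g this] have "r = g * c + (j + (g - 1) * (p + q)) mod g"
        using pqr(6) by (metis mult_div_mod_eq)
      then have "B = ?f (p, q)" using Beq by simp
      moreover have "(p, q) \<in> ?R"
      proof -
        have "p mod g < g" "q mod g < g" using g by auto
        moreover have "p = g * a + p mod g" "q = g * b + q mod g"
          using pqr by (metis mult_div_mod_eq)+
        ultimately have "g * a \<le> p" "p < g * a + g" "g * b \<le> q" "q < g * b + g"
          by linarith+
        then show ?thesis by simp
      qed
      ultimately show "B \<in> ?f ` ?R" by (rule image_eqI)
    qed
    have "card (?f ` ?R) \<le> card ?R" by (rule card_image_le) simp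
    also have "\<dots> = g\<^sup>2" by (simp add: power2_eq_square)
    finally have "card (?f ` ?R) \<le> g\<^sup>2" .
    moreover have "finite (?f ` ?R)" by simp
    ultimately show ?thesis
      using sub by (meson card_mono finite_subset order_trans)
  qed
  have eq: "blow_up g j A = (\<Union>C\<in>A. ?F C)" by (auto simp: blow_up_def)
  have "card (\<Union>C\<in>A. ?F C) \<le> (\<Sum>C\<in>A. card (?F C))" by (rule card_UN_le[OF fin])
  also have "\<dots> \<le> (\<Sum>C\<in>A. g\<^sup>2)" using F by (intro sum_mono) blast
  finally show ?thesis using eq by simp
qed

text \<open>The index \<open>k\<close> in \<open>{1..n * g}\<close> encodes a way of the original
  trade, shifted to start at 1, and a residue below \<open>g\<close>. Two indices differ in the way,
  so the projected blocks differ, or in the residue, so the block sums differ.\<close>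

lemma blow_up_trade:
  fixes X :: "nat set"
  assumes n: "2 \<le> n" and T: "is_mu_way_trade n v 3 2 X T" and g: "0 < g"
  shows "\<exists>v' X'. is_mu_way_trade (n * g) v' 3 2 X'
    (\<lambda>k. blow_up g ((k - 1) mod g) (T ((k - 1) div g + 1)))"
proof -
  let ?\<pi> = "\<lambda>p::nat. p div g"
  let ?i = "\<lambda>k. (k - 1) div g + 1" and ?j = "\<lambda>k. (k - 1) mod g"
  let ?T = "\<lambda>k. blow_up g (?j k) (T (?i k))"
  note fX = mu_way_trade_finite_points[OF n T] and blocks = mu_way_trade_block[OF n T]
    and bal = mu_way_trade_balanced[OF n T]
  define X' where "X' = {p. ?\<pi> p \<in> X}"
  have "X' \<subseteq> (\<Union>a\<in>X. {g * a..<g * a + g})"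
  proof
    fix p assume "p \<in> X'"
    moreover have "p \<in> {g * ?\<pi> p..<g * ?\<pi> p + g}"
      using g by (metis atLeastLessThan_iff le_add1 mod_less_divisor mult_div_mod_eq nat_add_left_cancel_less)
    ultimately show "p \<in> (\<Union>a\<in>X. {g * a..<g * a + g})" unfolding X'_def by blast
  qed
  then have fX': "finite X'" using fX by (auto intro: finite_subset)
  have i: "?i k \<in> {1..n}" if "k \<in> {1..n * g}" for k
  proof -
    have "k - 1 < n * g" using that g n by auto
    then have "(k - 1) div g < n" by (rule less_mult_imp_div_less)
    then show ?thesis by simp
  qed
  have j: "?j k < g" for k using g by simp
  have blocks': "B \<subseteq> X' \<and> card B = 3" if "B \<in> ?T k" "k \<in> {1..n * g}" for B k
    using that blocks[OF _ i] unfolding blow_up_def X'_def by blast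
  have three: "card C = 3" if "C \<in> T (?i k)" "k \<in> {1..n * g}" for C k
    using blocks[OF that(1) i[OF that(2)]] by blast
  have bal': "card {B \<in> ?T k. S \<subseteq> B} = card {B \<in> ?T l. S \<subseteq> B}"
    if kl: "k \<in> {1..n * g}" "l \<in> {1..n * g}" and S: "S \<subseteq> X'" "card S = 2" for k l S
  proof (cases "card (?\<pi> ` S) = 2")
    case True
    have "card {B \<in> ?T k. S \<subseteq> B} = card {C \<in> T (?i k). ?\<pi> ` S \<subseteq> C}"
      by (rule card_blow_up_cover[OF three[OF _ kl(1)] j S(2) True])
    also have "\<dots> = card {C \<in> T (?i l). ?\<pi> ` S \<subseteq> C}"
      using S by (intro bal i kl True) (auto simp: X'_def)
    also have "\<dots> = card {B \<in> ?T l. S \<subseteq> B}"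
      by (rule card_blow_up_cover[OF three[OF _ kl(2)] j S(2) True, symmetric])
    finally show ?thesis .
  next
    case False
    then show ?thesis
      using blow_up_cover_empty[OF three[OF _ kl(1)] S(2) False]
        blow_up_cover_empty[OF three[OF _ kl(2)] S(2) False] by (simp only:)
  qed
  have ne: "?T k \<noteq> {}" if k: "k \<in> {1..n * g}" for k
  proof -
    obtain C where C: "C \<in> T (?i k)"
      using T i[OF k] unfolding mu_way_trade_iff[OF n] by blast
    then obtain a b c where abc: "C = {a, b, c}" "a \<noteq> b"
      using three[OF C k] by (auto simp: card_3_iff)
    \<comment> \<open>Copies with residue 0 of two points of \<open>C\<close>. Since
      \<open>C\<close> covers their projections, some block of the blow-up covers them.\<close>
    define S where "S = {g * a, g * b}"
    have \<pi>S: "?\<pi> ` S = {a, b}" using g by (simp add: S_def)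
    have "card S = 2" "card (?\<pi> ` S) = 2" using g abc by (auto simp: S_def)
    then have "card {B \<in> ?T k. S \<subseteq> B} = card {C \<in> T (?i k). ?\<pi> ` S \<subseteq> C}"
      by (intro card_blow_up_cover[OF three[OF _ k] j])
    moreover have "C \<in> {C \<in> T (?i k). ?\<pi> ` S \<subseteq> C}" using C abc \<pi>S by simp
    moreover have "finite {C \<in> T (?i k). ?\<pi> ` S \<subseteq> C}"
      using mu_way_trade_finite[OF n T i[OF k]] by simp
    ultimately have "card {B \<in> ?T k. S \<subseteq> B} \<noteq> 0" by (metis card_0_eq empty_iff)
    then show ?thesis by (metis (no_types, lifting) card.empty empty_Collect_eq empty_iff)
  qed
  have disj: "?T k \<inter> ?T l = {}" if kl: "k \<in> {1..n * g}" "l \<in> {1..n * g}" "k \<noteq> l" for k l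
  proof (cases "?i k = ?i l")
    case True
    have "k - 1 \<noteq> l - 1" using kl by auto
    then have "?j k \<noteq> ?j l" using True by (metis add_right_cancel div_mult_mod_eq)
    then show ?thesis by (auto simp: blow_up_def)
  next
    case False
    then have "T (?i k) \<inter> T (?i l) = {}"
      by (rule mu_way_trade_disjoint[OF n T i[OF kl(1)] i[OF kl(2)]])
    then show ?thesis unfolding blow_up_def by blast
  qed
  have "is_trade (card X') 3 2 X' (?T k) (?T l)"
    if kl: "k \<in> {1..n * g}" "l \<in> {1..n * g}" "k \<noteq> l" for k l
    unfolding is_trade_def
    using fX' ne[OF kl(1)] ne[OF kl(2)] disj[OF kl] blocks'[OF _ kl(1)] blocks'[OF _ kl(2)]
      bal'[OF kl(1,2)] by blast
  then show ?thesis unfolding is_mu_way_trade_def by blast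
qed

section \<open>Comparison of the two bounds\<close>

text \<open>Taking \<open>g = 1\<close> gives the bound for the base alone, so this one lemma serves
  every range of \<mu>.\<close>

lemma min_volume_le_rotation_base:
  assumes base: "rotation_base n D" and n: "2 \<le> n" and g: "0 < g"
    and \<mu>: "2 \<le> \<mu>" "\<mu> \<le> n * g"
  shows "min_volume \<mu> 3 2 \<le> length D * g\<^sup>2"
proof -
  let ?T = "\<lambda>i. (\<lambda>B. (rot n ^^ i) ` B) ` set3 ` set D"
  obtain v X where T: "is_mu_way_trade n v 3 2 X ?T" using rotation_base_trade[OF base] by blast
  from blow_up_trade[OF n T g] obtain v' X' where
    T': "is_mu_way_trade (n * g) v' 3 2 X' (\<lambda>k. blow_up g ((k - 1) mod g) (?T ((k - 1) div g + 1)))"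
    by blast
  have "card (?T 1) \<le> length D"
    by (meson card_image_le card_length finite_imageI finite_set order_trans)
  moreover have "card (blow_up g ((1 - 1) mod g) (?T ((1 - 1) div g + 1))) \<le> card (?T 1) * g\<^sup>2"
    using card_blow_up_le[OF _ _ g, of "?T 1" 0] mu_way_trade_block[OF n T, of _ 1] n by simp
  ultimately have "card (blow_up g ((1 - 1) mod g) (?T ((1 - 1) div g + 1))) \<le> length D * g\<^sup>2"
    by (meson mult_le_mono1 order_trans)
  with min_volume_le[OF \<mu> T'] show ?thesis by blast
qed

text \<open>The right-hand side is the bound of \<open>non_steiner_volume_ge\<close>. It increases
  with \<mu>, so on each range served by one fixed construction only the least \<mu> has to be
  checked.\<close>

lemma min_volume_less:
  assumes "3 \<le> \<mu>"
  shows "3 * min_volume \<mu> 3 2 < 2 * (\<mu> + 1) + 2 * \<mu> * (\<mu> div 2 + 1)"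
proof -
  note bound = min_volume_le_rotation_base
  have \<mu>: "2 \<le> \<mu>" using assms by simp
  have mono: "2 * (m + 1) + 2 * m * (m div 2 + 1) \<le> 2 * (\<mu> + 1) + 2 * \<mu> * (\<mu> div 2 + 1)"
    if "m \<le> \<mu>" for m
    using that by (intro add_mono mult_le_mono div_le_mono) auto
  consider "\<mu> = 3" | "\<mu> = 4" | "\<mu> \<in> {5..7}" | "\<mu> \<in> {8..11}" | "\<mu> \<in> {12..17}" | "\<mu> \<in> {18..22}"
    | "\<mu> \<in> {23..28}" | "29 \<le> \<mu>"
    using assms by fastforce
  then show ?thesis
  proof cases
    case 1
    then have "min_volume \<mu> 3 2 \<le> 6"
      using bound[OF rotation_base3, of 1 \<mu>] by (simp add: length_base3)
    then have "3 * min_volume \<mu> 3 2 < 2 * (3 + 1) + 2 * 3 * (3 div 2 + 1)" by simp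
    then show ?thesis using mono[of 3] 1 by (auto intro: less_le_trans)
  next
    case 2
    then have "min_volume \<mu> 3 2 \<le> 8"
      using bound[OF rotation_base4, of 1 \<mu>] by (simp add: length_base4)
    then have "3 * min_volume \<mu> 3 2 < 2 * (4 + 1) + 2 * 4 * (4 div 2 + 1)" by simp
    then show ?thesis using mono[of 4] 2 by (auto intro: less_le_trans)
  next
    case 3
    then have "min_volume \<mu> 3 2 \<le> 12"
      using bound[OF rotation_base7, of 1 \<mu>] by (simp add: length_base7)
    then have "3 * min_volume \<mu> 3 2 < 2 * (5 + 1) + 2 * 5 * (5 div 2 + 1)" by simp
    then show ?thesis using mono[of 5] 3 by (auto intro: less_le_trans)
  next
    case 4
    then have "min_volume \<mu> 3 2 \<le> 26"
      using bound[OF rotation_base11, of 1 \<mu>] by (simp add: length_base11)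
    then have "3 * min_volume \<mu> 3 2 < 2 * (8 + 1) + 2 * 8 * (8 div 2 + 1)" by simp
    then show ?thesis using mono[of 8] 4 by (auto intro: less_le_trans)
  next
    case 5
    then have "min_volume \<mu> 3 2 \<le> 57"
      using bound[OF rotation_base17, of 1 \<mu>] by (simp add: length_base17)
    then have "3 * min_volume \<mu> 3 2 < 2 * (12 + 1) + 2 * 12 * (12 div 2 + 1)" by simp
    then show ?thesis using mono[of 12] 5 by (auto intro: less_le_trans)
  next
    case 6
    then have "min_volume \<mu> 3 2 \<le> 104"
      using bound[OF rotation_base11, of 2 \<mu>] by (simp add: length_base11)
    then have "3 * min_volume \<mu> 3 2 < 2 * (18 + 1) + 2 * 18 * (18 div 2 + 1)" by simp
    then show ?thesis using mono[of 18] 6 by (auto intro: less_le_trans)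
  next
    case 7
    then have "min_volume \<mu> 3 2 \<le> 192"
      using bound[OF rotation_base7, of 4 \<mu>] by (simp add: length_base7)
    then have "3 * min_volume \<mu> 3 2 < 2 * (23 + 1) + 2 * 23 * (23 div 2 + 1)" by simp
    then show ?thesis using mono[of 23] 7 by (auto intro: less_le_trans)
  next
    case 8
    \<comment> \<open>The least \<open>g\<close> for which the \<open>7 * g\<close> ways suffice.
      The quadratic inequality below holds at \<open>g = 5\<close> but fails at
      \<open>g = 4\<close>, which is why this case starts at 29.\<close>
    define g where "g = (\<mu> + 6) div 7"
    have g: "5 \<le> g" "\<mu> \<le> 7 * g" "7 * g \<le> \<mu> + 6" using 8 by (auto simp: g_def)
    have "min_volume \<mu> 3 2 \<le> 12 * g\<^sup>2"
      using bound[OF rotation_base7, of g \<mu>] g \<mu> by (simp add: length_base7)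
    then have 1: "3 * min_volume \<mu> 3 2 \<le> 36 * g\<^sup>2" by simp
    \<comment> \<open>In terms of \<open>d\<close> the subtractions disappear and the inequality can
      be compared coefficientwise.\<close>
    obtain d where d: "g = d + 5" using g(1) by (metis add.commute le_Suc_ex)
    have "36 * g\<^sup>2 < (7 * g - 5) * (7 * g - 4)"
      by (simp add: d power2_eq_square algebra_simps)
    also have "\<dots> \<le> (\<mu> + 1) * (\<mu> + 2)" using g by (intro mult_le_mono) auto
    also have "\<dots> \<le> 2 * (\<mu> + 1) + \<mu> * (2 * (\<mu> div 2 + 1))"
    proof -
      have "\<mu> * (\<mu> + 1) \<le> \<mu> * (2 * (\<mu> div 2 + 1))" by (intro mult_le_mono2) auto
      then show ?thesis by (simp add: algebra_simps)
    qed
    finally show ?thesis using 1 by (simp add: ac_simps)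
  qed
qed

theorem theorem3p5:
  fixes \<mu> v :: nat and X :: "'a set" and T :: "nat \<Rightarrow> 'a set set"
  assumes "\<mu> \<ge> 3"
    and "is_mu_way_trade \<mu> v 3 2 X T"
    and "has_volume \<mu> T (min_volume \<mu> 3 2)"
  shows "is_steiner \<mu> 2 X T"
proof (rule ccontr)
  assume "\<not> is_steiner \<mu> 2 X T"
  moreover have "2 \<le> \<mu>" "card (T 1) = min_volume \<mu> 3 2"
    using assms(1,3) by (auto simp: has_volume_def)
  ultimately show False
    using non_steiner_volume_ge[of \<mu> v X T] min_volume_less[OF assms(1)] assms(2) by simp
qed

end
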